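(* Let $\mathbb{M}^d=(\mathbb{R}^d,\|\cdot\|)$ be a finite-dimensional real normed space. For every (nonempty) bounded set $K\subset\mathbb{M}^d$ there exists a completion $K^c$ of $K$ such that $\lambda_K=\lambda_{K^c}$ and $\mathrm{Ch}(K^c)\subseteq \mathrm{Ch}(K)$.
   Context: $B(x,\lambda)=\{y:\|y-x\|\le\lambda\}$ denotes the closed ball with center $x$ and radius $\lambda$. For a nonempty bounded set $K$, $\operatorname{diam}(K)=\sup\{\|x-y\|:x,y\in K\}$. The minimal enclosing radius (Chebyshev radius) $\lambda_K$ is the smallest number such that $K\subseteq B(x,\lambda_K)$ for some $x$; such a ball $B(x,\lambda_K)$ is a minimal enclosing ball of $K$. The Chebyshev set $\mathrm{Ch}(K)$ is the set of all centers $x$ of minimal enclosing balls of $K$. A bounded set is complete if it cannot be enlarged by additional points without increasing its diameter. A completion of $K$ is a complete set that contains $K$ and has the same diameter as $K$. *)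

theory Defs
  imports "HOL-Analysis.Analysis"
begin

text \<open>
  Finite dimensionality is a hypothesis on the type, not the class \<open>euclidean_space\<close>: that class
  forces the norm to come from an inner product, whereas here the norm is arbitrary.
\<close>

definition finite_dimensional :: "'a::real_vector itself \<Rightarrow> bool" where
  "finite_dimensional _ \<longleftrightarrow> (\<exists>B::'a set. finite B \<and> span B = UNIV)"

text \<open>
  Meaningful for nonempty bounded sets in a finite-dimensional space, where the least value
  exists; elsewhere \<open>LEAST\<close> may return an unspecified number.
\<close>

definition chebyshev_radius :: "'a::real_normed_vector set \<Rightarrow> real" where
  "chebyshev_radius K = (LEAST r. \<exists>x. K \<subseteq> cball x r)"

definition chebyshev_set :: "'a::real_normed_vector set \<Rightarrow> 'a set" where
  "chebyshev_set K = {x. K \<subseteq> cball x (chebyshev_radius K)}"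

text \<open>
  Completeness with respect to the diameter; unrelated to the Cauchy-completeness predicate
  \<open>complete\<close>. Only bounded enlargements are tested, because \<open>diameter\<close> is unspecified on
  unbounded sets, whose mathematical diameter is infinite and hence larger anyway.
\<close>

definition diam_complete :: "'a::real_normed_vector set \<Rightarrow> bool" where
  "diam_complete C \<longleftrightarrow>
     bounded C \<and> (\<forall>D. C \<subset> D \<and> bounded D \<longrightarrow> diameter C < diameter D)"

definition is_completion :: "'a::real_normed_vector set \<Rightarrow> 'a set \<Rightarrow> bool" where
  "is_completion K C \<longleftrightarrow> diam_complete C \<and> K \<subseteq> C \<and> diameter C = diameter K"

end

theory Submission imports Defs begin

text \<open>
  Let \<open>d\<close> be the diameter of \<open>K\<close>, fix a minimal enclosing ball \<open>B(x, r)\<close> of \<open>K\<close>, and let \<open>C\<close> be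
  maximal among the sets of diameter at most \<open>d\<close> between \<open>K\<close> and \<open>B(x, r)\<close>. Suppose a point \<open>y\<close>
  outside \<open>C\<close> has distance at most \<open>d\<close> from all of \<open>C\<close>. By maximality \<open>y\<close> is outside the ball.
  As \<open>r \<le> d \<le> 2 r\<close>, the point \<open>z\<close> opposite to \<open>y\<close> at distance \<open>d - r\<close> from \<open>x\<close> lies in the ball and
  within \<open>d\<close> of every point of it, so \<open>z \<in> C\<close>; but \<open>y\<close> and \<open>z\<close> are more than \<open>r + (d - r) = d\<close>
  apart. Finite dimension is needed only for the existence of a minimal enclosing ball.
\<close>

text \<open>Heine-Borel for an arbitrary norm. A vector \<open>b\<close> outside
  \<open>span B\<close> has positive distance \<delta> from it, so in a vector of norm at most
  \<open>r\<close> the coefficient of \<open>b\<close> is at most \<open>r / \<delta>\<close> in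
  absolute value. The ball in the larger span is then a closed part of a continuous image of a
  compact product.\<close>

lemma compact_span_Int_cball:
  fixes B :: "'a::real_normed_vector set"
  assumes "finite B"
  shows "compact (span B \<inter> cball 0 r)"
  using assms
proof (induction B arbitrary: r rule: finite_induct)
  case empty
  then show ?case by (simp add: finite_imp_compact)
next
  case (insert b B)
  show ?case
  proof (cases "b \<in> span B")
    case True
    then show ?thesis using insert.IH by (simp add: span_redundant)
  next
    case False
    \<comment> \<open>The induction hypothesis yields closedness only of bounded pieces of
      \<open>span B\<close>. The radius \<open>norm b + 1\<close> covers all points within distance
      1 of \<open>b\<close>, which explains the 1 in \<open>\<delta>\<close>.\<close>
    have "closed (span B \<inter> cball 0 (norm b + 1))"
      using insert.IH compact_imp_closed by blast
    then obtain e where e: "e > 0"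
      "\<And>w. dist w b < e \<Longrightarrow> w \<notin> span B \<inter> cball 0 (norm b + 1)"
      using False unfolding closed_def open_dist by (metis ComplD ComplI IntD1)
    define \<delta> where "\<delta> = min e 1"
    have \<delta>: "\<delta> > 0" using e by (simp add: \<delta>_def)
    have far: "\<delta> \<le> norm (b - w)" if w: "w \<in> span B" for w
    proof (rule ccontr)
      assume "\<not> \<delta> \<le> norm (b - w)"
      then have d: "dist w b < e" "norm (b - w) < 1"
        by (auto simp: \<delta>_def dist_norm norm_minus_commute)
      then have "norm w \<le> norm b + 1"
        using norm_triangle_ineq4[of b "b - w"] by simp
      then show False using e(2)[OF d(1)] w by simp
    qed
    have scaled: "\<bar>a\<bar> * \<delta> \<le> norm (a *\<^sub>R b + w)" if w: "w \<in> span B" for a w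
    proof (cases "a = 0")
      case False
      have "\<delta> \<le> norm (b - (- 1 / a) *\<^sub>R w)"
        by (intro far span_scale w)
      moreover have "a *\<^sub>R b + w = a *\<^sub>R (b - (- 1 / a) *\<^sub>R w)"
        using False by (simp add: algebra_simps)
      ultimately show ?thesis by (simp add: mult_left_mono)
    qed simp
    \<comment> \<open>The first bound is that of \<open>scaled\<close>; the second follows from it
      by the triangle inequality. \<open>I\<close> may contain vectors longer than \<open>r\<close>,
      hence the later intersection with the ball.\<close>
    define I where "I = (\<lambda>(a, w). a *\<^sub>R b + w) `
      ({- (r / \<delta>)..r / \<delta>} \<times> (span B \<inter> cball 0 (r + r / \<delta> * norm b)))"
    have "compact I"
      unfolding I_def case_prod_beta
      by (intro compact_continuous_image compact_Times insert.IH continuous_intros compact_Icc)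
    moreover have "span (insert b B) \<inter> cball 0 r = I \<inter> cball 0 r"
    proof (intro equalityI subsetI)
      fix v assume v: "v \<in> span (insert b B) \<inter> cball 0 r"
      then obtain a where a: "v - a *\<^sub>R b \<in> span B"
        using span_breakdown_eq by blast
      have nv: "norm v \<le> r" using v by simp
      have "\<bar>a\<bar> * \<delta> \<le> r" using scaled[OF a, of a] nv by simp
      then have ar: "\<bar>a\<bar> \<le> r / \<delta>" using \<delta> by (simp add: field_simps)
      then have "\<bar>a\<bar> * norm b \<le> r / \<delta> * norm b" by (rule mult_right_mono) simp
      then have "norm (v - a *\<^sub>R b) \<le> r + r / \<delta> * norm b"
        using norm_triangle_ineq4[of v "a *\<^sub>R b"] nv by simp
      then have "(a, v - a *\<^sub>R b) \<in> {- (r / \<delta>)..r / \<delta>} \<times> (span B \<inter> cball 0 (r + r / \<delta> * norm b))"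
        using a ar by auto
      then have "v \<in> I" unfolding I_def by (rule rev_image_eqI) simp
      then show "v \<in> I \<inter> cball 0 r" using v by simp
    next
      fix v assume v: "v \<in> I \<inter> cball 0 r"
      then obtain a w where "v = a *\<^sub>R b + w" "w \<in> span B" by (auto simp: I_def)
      then have "v \<in> span (insert b B)" by (simp add: span_breakdown_eq exI[of _ a])
      then show "v \<in> span (insert b B) \<inter> cball 0 r" using v by simp
    qed
    ultimately show ?thesis by (simp add: compact_Int_closed)
  qed
qed

lemma finite_dimensional_compact_cball:
  fixes x :: "'a::real_normed_vector"
  assumes "finite_dimensional TYPE('a)"
  shows "compact (cball x r)"
proof -
  obtain B :: "'a set" where "finite B" "span B = UNIV"
    using assms by (auto simp: finite_dimensional_def)
  then have "compact (cball (0::'a) r)"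
    using compact_span_Int_cball[of B r] by simp
  then have "compact ((+) x ` cball 0 r)" by (rule compact_translation)
  then show ?thesis by (simp add: cball_translation[symmetric])
qed

text \<open>For every admissible radius the set \<open>F s\<close> of possible centers is compact
  and nonempty, and it grows with \<open>s\<close>. A point common to all these sets is a center for
  the infimum of the radii.\<close>

lemma minimal_enclosing_ball_exists:
  fixes K :: "'a::real_normed_vector set"
  assumes fd: "finite_dimensional TYPE('a)" and "K \<noteq> {}" and "bounded K"
  obtains x r where "K \<subseteq> cball x r" and "\<And>y s. K \<subseteq> cball y s \<Longrightarrow> r \<le> s"
proof -
  define R where "R = {r. \<exists>x. K \<subseteq> cball x r}"
  define F where "F = (\<lambda>s. {x. K \<subseteq> cball x s})"
  obtain k where k: "k \<in> K" using assms by blast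
  have R_nonempty: "R \<noteq> {}"
    using \<open>bounded K\<close> by (auto simp: R_def bounded_subset_cball)
  have "0 \<le> s" if "s \<in> R" for s
  proof -
    obtain y where "K \<subseteq> cball y s" using \<open>s \<in> R\<close> by (auto simp: R_def)
    then have "dist y k \<le> s" using k by auto
    then show ?thesis using zero_le_dist[of y k] by linarith
  qed
  then have bdd: "bdd_below R" by (auto simp: bdd_below_def)
  \<comment> \<open>Singling out the ball around \<open>k\<close> exhibits \<open>F s\<close> as a
    compact set intersected with a closed one.\<close>
  have F_eq: "F s = cball k s \<inter> (\<Inter>q\<in>K. cball q s)" for s
    using k by (auto simp: F_def subset_iff dist_commute)
  have compact_F: "compact (F s)" for s
    unfolding F_eq by (intro compact_Int_closed finite_dimensional_compact_cball[OF fd] closed_INT) auto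
  obtain s0 where s0: "s0 \<in> R" using R_nonempty by blast
  have "F s0 \<inter> (\<Inter>s\<in>R. F s) \<noteq> {}"
  proof (rule compact_imp_fip_image)
    show "compact (F s0)" by (rule compact_F)
    show "closed (F s)" for s using compact_F by (rule compact_imp_closed)
    fix R' assume R': "finite R'" "R' \<subseteq> R"
    \<comment> \<open>By monotonicity, a center for the smallest of finitely many radii serves all
      of them.\<close>
    define m where "m = Min (insert s0 R')"
    have "m \<in> insert s0 R'" unfolding m_def using R' by (intro Min_in) auto
    then have "m \<in> R" using R' s0 by blast
    then obtain x where x: "K \<subseteq> cball x m" by (auto simp: R_def)
    have "x \<in> F s" if "s \<in> insert s0 R'" for s
    proof -
      have "m \<le> s" unfolding m_def using that R' by (intro Min_le) auto
      then show ?thesis using x subset_cball[of m s x] by (auto simp: F_def)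
    qed
    then show "F s0 \<inter> (\<Inter>s\<in>R'. F s) \<noteq> {}" by blast
  qed
  then obtain x where x: "\<And>s. s \<in> R \<Longrightarrow> K \<subseteq> cball x s" by (auto simp: F_def)
  have "K \<subseteq> cball x (Inf R)"
  proof
    fix q assume "q \<in> K"
    then have "dist x q \<le> s" if "s \<in> R" for s using x[OF that] by auto
    then have "dist x q \<le> Inf R" using R_nonempty by (intro cInf_greatest)
    then show "q \<in> cball x (Inf R)" by simp
  qed
  moreover have "Inf R \<le> s" if "K \<subseteq> cball y s" for y s
    using that bdd by (intro cInf_lower) (auto simp: R_def)
  ultimately show ?thesis by (rule that)
qed

lemma chebyshev_radius_eqI:
  assumes "K \<subseteq> cball x r" and "\<And>y s. K \<subseteq> cball y s \<Longrightarrow> r \<le> s"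
  shows "chebyshev_radius K = r"
  unfolding chebyshev_radius_def using assms by (intro Least_equality) auto

text \<open>Zorn's lemma applies because two points of the union of a chain already lie in one
  member, so the distance bound passes to the union. The last conclusion is maximality in the
  pointwise form used below.\<close>

lemma maximal_superset_of_bounded_dist:
  fixes K :: "'a::metric_space set"
  assumes "K \<subseteq> B" and "\<And>p q. p \<in> K \<Longrightarrow> q \<in> K \<Longrightarrow> dist p q \<le> d" and "0 \<le> d"
  obtains C where "K \<subseteq> C" "C \<subseteq> B" "\<And>p q. p \<in> C \<Longrightarrow> q \<in> C \<Longrightarrow> dist p q \<le> d"
    "\<And>y. y \<in> B \<Longrightarrow> (\<And>p. p \<in> C \<Longrightarrow> dist y p \<le> d) \<Longrightarrow> y \<in> C"
proof -
  define A where "A = {S. K \<subseteq> S \<and> S \<subseteq> B \<and> (\<forall>p\<in>S. \<forall>q\<in>S. dist p q \<le> d)}"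
  have "\<exists>M\<in>A. \<forall>X\<in>A. M \<subseteq> X \<longrightarrow> X = M"
  proof (rule subset_Zorn_nonempty)
    show "A \<noteq> {}" using assms by (auto simp: A_def)
    fix \<C> assume "\<C> \<noteq> {}" and ch: "subset.chain A \<C>"
    have sub: "\<C> \<subseteq> A" using ch by (simp add: subset.chain_def)
    have "dist p q \<le> d" if pq: "p \<in> \<Union>\<C>" "q \<in> \<Union>\<C>" for p q
    proof -
      obtain S T where "S \<in> \<C>" "T \<in> \<C>" "p \<in> S" "q \<in> T" using pq by blast
      moreover from this have "S \<subseteq> T \<or> T \<subseteq> S" using ch by (auto simp: subset_chain_def)
      ultimately obtain U where "U \<in> \<C>" "p \<in> U" "q \<in> U" by blast
      then show ?thesis using sub by (auto simp: A_def)
    qed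
    then show "\<Union>\<C> \<in> A" using sub \<open>\<C> \<noteq> {}\<close> by (fastforce simp: A_def)
  qed
  then obtain C where C: "C \<in> A" and max: "\<And>X. X \<in> A \<Longrightarrow> C \<subseteq> X \<Longrightarrow> X = C" by blast
  show ?thesis
  proof (rule that)
    show "K \<subseteq> C" "C \<subseteq> B" "\<And>p q. p \<in> C \<Longrightarrow> q \<in> C \<Longrightarrow> dist p q \<le> d"
      using C by (auto simp: A_def)
    show "y \<in> C" if "y \<in> B" "\<And>p. p \<in> C \<Longrightarrow> dist y p \<le> d" for y
    proof -
      \<comment> \<open>\<open>0 \<le> d\<close> settles the distance of \<open>y\<close> to
        itself.\<close>
      have "insert y C \<in> A" using C that \<open>0 \<le> d\<close> by (auto simp: A_def dist_commute)
      then show ?thesis using max by blast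
    qed
  qed
qed

lemma completion_within_cball:
  fixes K :: "'a::real_normed_vector set"
  assumes "K \<noteq> {}" and K: "K \<subseteq> cball x r" and r: "r \<le> diameter K"
  obtains C where "is_completion K C" and "C \<subseteq> cball x r"
proof -
  define d where "d = diameter K"
  have bK: "bounded K" using K bounded_cball bounded_subset by blast
  have r0: "0 \<le> r" using assms(1) K by (metis cball_eq_empty not_le subset_empty)
  have d0: "0 \<le> d" using bK by (simp add: d_def diameter_ge_0)
  have "d \<le> diameter (cball x r)" unfolding d_def by (intro diameter_subset K bounded_cball)
  also have "\<dots> \<le> 2 * r"
  proof (rule diameter_le)
    show "norm (p - q) \<le> 2 * r" if "p \<in> cball x r" "q \<in> cball x r" for p q
      using that dist_triangle3[of p q x] by (simp add: dist_norm)
  qed (use r0 in simp)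
  finally have d2: "d \<le> 2 * r" .
  obtain C where KC: "K \<subseteq> C" and CB: "C \<subseteq> cball x r"
    and dist: "\<And>p q. p \<in> C \<Longrightarrow> q \<in> C \<Longrightarrow> dist p q \<le> d"
    and max: "\<And>y. y \<in> cball x r \<Longrightarrow> (\<And>p. p \<in> C \<Longrightarrow> dist y p \<le> d) \<Longrightarrow> y \<in> C"
    using maximal_superset_of_bounded_dist[OF K _ d0] diameter_bounded_bound[OF bK]
    unfolding d_def by blast
  have bC: "bounded C" using CB bounded_cball bounded_subset by blast
  have "diameter C \<le> d" using d0 dist by (intro diameter_le) (auto simp: dist_norm)
  moreover have "d \<le> diameter C" unfolding d_def by (intro diameter_subset KC bC)
  ultimately have dC: "diameter C = d" by simp
  have in_C: "y \<in> C" if y: "\<And>p. p \<in> C \<Longrightarrow> dist y p \<le> d" for y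
  proof (rule max[OF _ y])
    show "y \<in> cball x r"
    proof (rule ccontr)
      assume "y \<notin> cball x r"
      then have t: "norm (y - x) > r" by (simp add: dist_norm norm_minus_commute)
      have "y \<noteq> x" using t r0 by auto
      define u where "u = sgn (y - x)"
      have y_eq: "y = x + norm (y - x) *\<^sub>R u" and u: "norm u = 1"
        using \<open>y \<noteq> x\<close> by (simp_all add: u_def sgn_div_norm)
      define z where "z = x - (d - r) *\<^sub>R u"
      have xz: "dist x z = d - r" using r u by (simp add: z_def d_def dist_norm)
      have "z \<in> C"
      proof (rule max)
        show "z \<in> cball x r" using xz d2 by simp
        show "dist z p \<le> d" if "p \<in> C" for p
        proof -
          have "dist x p \<le> r" using that CB by auto
          then show ?thesis using dist_triangle3[of z p x] xz by linarith
        qed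
      qed
      \<comment> \<open>\<open>x\<close> lies on the segment from \<open>y\<close> to
        \<open>z\<close>, so the two distances add up exactly in any norm.\<close>
      have "y - z = (norm (y - x) + (d - r)) *\<^sub>R u"
        by (subst y_eq) (simp add: z_def algebra_simps)
      then have "dist y z = norm (y - x) + (d - r)"
        using u r by (simp add: dist_norm d_def)
      then show False using y[OF \<open>z \<in> C\<close>] t by simp
    qed
  qed
  \<comment> \<open>An enlargement that keeps the diameter would consist of points within
    \<open>d\<close> of all of \<open>C\<close>, and \<open>in_C\<close> places these in
    \<open>C\<close>.\<close>
  have "diameter C < diameter D" if D: "C \<subset> D" "bounded D" for D
  proof (rule ccontr)
    assume "\<not> diameter C < diameter D"
    then have "dist y p \<le> d" if "y \<in> D" "p \<in> D" for y p
      using diameter_bounded_bound[OF D(2) that] dC by simp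
    then show False using D(1) in_C by blast
  qed
  then have "is_completion K C"
    using bC KC dC by (simp add: is_completion_def diam_complete_def d_def)
  then show ?thesis using CB by (rule that)
qed

theorem lemma2:
  fixes K :: "'a::real_normed_vector set"
  assumes "finite_dimensional TYPE('a)"
    and "K \<noteq> {}" and "bounded K"
  shows "\<exists>C. is_completion K C \<and> chebyshev_radius K = chebyshev_radius C
           \<and> chebyshev_set C \<subseteq> chebyshev_set K"
proof -
  obtain x r where K: "K \<subseteq> cball x r" and least: "\<And>y s. K \<subseteq> cball y s \<Longrightarrow> r \<le> s"
    using minimal_enclosing_ball_exists[OF assms] by metis
  obtain k where k: "k \<in> K" using assms(2) by blast
  \<comment> \<open>A ball around any point of \<open>K\<close> with the diameter as radius encloses
    \<open>K\<close>, which gives the bound \<open>r \<le> d\<close> needed for the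
    completion.\<close>
  have "K \<subseteq> cball k (diameter K)"
    using diameter_bounded_bound[OF assms(3) k] by auto
  then have "r \<le> diameter K" by (rule least)
  then obtain C where C: "is_completion K C" "C \<subseteq> cball x r"
    using completion_within_cball[OF assms(2) K] by blast
  have KC: "K \<subseteq> C" using C(1) by (simp add: is_completion_def)
  have "chebyshev_radius K = r" using K least by (rule chebyshev_radius_eqI)
  \<comment> \<open>Every ball enclosing \<open>C\<close> encloses \<open>K\<close>, so its radius
    is at least \<open>r\<close>. With equal radii the same remark gives the inclusion of the
    Chebyshev sets.\<close>
  moreover have "chebyshev_radius C = r"
    using C(2) least KC by (intro chebyshev_radius_eqI) blast+
  ultimately show ?thesis
    using C(1) KC by (intro exI[of _ C]) (auto simp: chebyshev_set_def)
qed

end
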